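(* Consider the low order forward Euler scheme for the two-dimensional shallow water equations on a finite connectivity graph described in the context, $$\frac{m_i}{dt}\left(\mathbf{u}_i^{n+1}-\mathbf{u}_i^{n}\right)+\sum_{j\in I(i)}\mathbf{f}(\mathbf{u}_j^n)\,\mathbf{Q}_{ij}-\sum_{j\in I(i)\setminus\{i\}}d_{ij}^{n}\left(\mathbf{u}_j^n-\mathbf{u}_i^n\right)=m_i\,\mathbf{S}(\mathbf{u}^n)_i,\qquad i\in V,$$ with graph viscosity coefficients, for $i\in V$ and $j\in I(i)\setminus\{i\}$, $$d_{ij}^{n}=\max\left(\lambda_{\max}(\mathbf{u}_i^n,\mathbf{u}_j^n)\,\|\mathbf{Q}_{ij}\|_{2},\ \lambda_{\max}(\mathbf{u}_j^n,\mathbf{u}_i^n)\,\|\mathbf{Q}_{ji}\|_{2}\right).$$ Set $d_{ii}^{n}=-\sum_{j\in I(i)\setminus\{i\}}d_{ij}^{n}$. Suppose that the time step $dt>0$ satisfies $2\,dt\,|d_{ii}^{n}|<m_i$ for every $i\in V$. Then the scheme preserves positivity of the water height: if $h_i^n>0$ for all $i\in V$, then $h_i^{n+1}>0$ for all $i\in V$.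
   Context: **Graph and operators.** $V$ is a finite set of nodes. Each $i\in V$ has a neighborhood $I(i)\subseteq V$ with $i\in I(i)$, and $j\in I(i)$ if and only if $i\in I(j)$. The numbers $m_i>0$ are the diagonal entries of the (diagonal) mass matrix. For $i\in V$ and $j\in I(i)$, $\mathbf{Q}_{ij}=(Q_{x,ij},Q_{y,ij})\in\mathbb{R}^2$ collects the entries of the low order differentiation operators in the $x$ and $y$ directions. These are assumed to satisfy $$\mathbf{Q}_{ij}=-\mathbf{Q}_{ji},\qquad \sum_{j\in I(i)}\mathbf{Q}_{ij}=\mathbf{0}\quad\text{for all } i\in V,$$ and $\mathbf{Q}_{ij}\neq\mathbf{0}$ for $j\in I(i)\setminus\{i\}$ (so that the viscosity coefficients $d_{ij}^n=d_{ji}^n$ are positive for neighboring $i\ne j$ when the heights are positive). $\|\cdot\|_2$ is the Euclidean norm. **States, flux and source.** The state at node $i$ and time step $n$ is $\mathbf{u}_i^n=(h_i^n,(hu)_i^n,(hv)_i^n)^T\in\mathbb{R}^3$, where $h$ is the water height. When $h_i^n>0$, the velocities are $u_i^n=(hu)_i^n/h_i^n$ and $v_i^n=(hv)_i^n/h_i^n$. The constant $g>0$ is the gravitational constant. The flux is the $3\times 2$ matrix $$\mathbf{f}(\mathbf{u})=\begin{pmatrix}hu & hv\\ hu^2+\tfrac12 gh^2 & huv\\ huv & hv^2+\tfrac12 gh^2\end{pmatrix},$$ and $\mathbf{f}(\mathbf{u}_j)\mathbf{Q}_{ij}\in\mathbb{R}^3$ is the matrix-vector product. The source term, for given bathymetry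 values $b_j$, is $$\mathbf{S}(\mathbf{u}^n)_i=-g\left(0,\ h_i^n\sum_{j\in I(i)}Q_{x,ij}b_j,\ h_i^n\sum_{j\in I(i)}Q_{y,ij}b_j\right)^T;$$ in particular its height component is zero. **Wave speed estimate.** For $j\in I(i)\setminus\{i\}$ let $\mathbf{n}_{ij}=\mathbf{Q}_{ij}/\|\mathbf{Q}_{ij}\|_2$ and $$\lambda_{\max}(\mathbf{u}_i^n,\mathbf{u}_j^n)=\left|(u_i^n,v_i^n)\cdot\mathbf{n}_{ij}\right|+\sqrt{g h_i^n},$$ and similarly $\lambda_{\max}(\mathbf{u}_j^n,\mathbf{u}_i^n)=\left|(u_j^n,v_j^n)\cdot\mathbf{n}_{ji}\right|+\sqrt{g h_j^n}$. *)

theory Defs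
  imports "HOL-Analysis.Analysis"
begin

text \<open>
  \<^term>\<open>Q i j\<close> is the vector of the entries $(Q_{x,ij}, Q_{y,ij})$. Its values are constrained,
  and used, only for \<^term>\<open>i \<in> V\<close> and \<^term>\<open>j \<in> I i\<close>.
\<close>

locale connectivity_graph =
  fixes V :: "'v set"
    and I :: "'v \<Rightarrow> 'v set"
    and m :: "'v \<Rightarrow> real"
    and Q :: "'v \<Rightarrow> 'v \<Rightarrow> real ^ 2"
  assumes finite_nodes: "finite V"
    and nbhd_subset: "\<And>i. i \<in> V \<Longrightarrow> I i \<subseteq> V"
    and nbhd_refl: "\<And>i. i \<in> V \<Longrightarrow> i \<in> I i"
    and nbhd_sym: "\<And>i j. \<lbrakk>i \<in> V; j \<in> V\<rbrakk> \<Longrightarrow> j \<in> I i \<longleftrightarrow> i \<in> I j"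
    and mass_pos: "\<And>i. i \<in> V \<Longrightarrow> m i > 0"
    and Q_antisym: "\<And>i j. \<lbrakk>i \<in> V; j \<in> I i\<rbrakk> \<Longrightarrow> Q i j = - Q j i"
    and Q_row_sum: "\<And>i. i \<in> V \<Longrightarrow> (\<Sum>j\<in>I i. Q i j) = 0"
    and Q_nonzero: "\<And>i j. \<lbrakk>i \<in> V; j \<in> I i - {i}\<rbrakk> \<Longrightarrow> Q i j \<noteq> 0"

text \<open>A state is the vector $(h, hu, hv)$ of conserved variables.\<close>

type_synonym state = "real ^ 3"

definition height :: "state \<Rightarrow> real"
  where "height w = w $ 1"

text \<open>Meaningful only for positive height; for zero height division yields the zero vector.\<close>

definition velocity :: "state \<Rightarrow> real ^ 2"
  where "velocity w = vector [w $ 2 / height w, w $ 3 / height w]"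

definition flux :: "real \<Rightarrow> state \<Rightarrow> real ^ 2 ^ 3"
  where "flux g w =
    (let h = height w; u = velocity w $ 1; v = velocity w $ 2
     in vector [vector [w $ 2, w $ 3],
                vector [h * u\<^sup>2 + g * h\<^sup>2 / 2, h * u * v],
                vector [h * u * v, h * v\<^sup>2 + g * h\<^sup>2 / 2]])"

definition source ::
    "real \<Rightarrow> ('v \<Rightarrow> 'v set) \<Rightarrow> ('v \<Rightarrow> 'v \<Rightarrow> real ^ 2) \<Rightarrow> ('v \<Rightarrow> real) \<Rightarrow> ('v \<Rightarrow> state) \<Rightarrow> 'v \<Rightarrow> state"
  where "source g I Q b u i =
    - g *\<^sub>R vector [0, height (u i) * (\<Sum>j\<in>I i. Q i j $ 1 * b j),
                      height (u i) * (\<Sum>j\<in>I i. Q i j $ 2 * b j)]"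

definition edge_normal :: "('v \<Rightarrow> 'v \<Rightarrow> real ^ 2) \<Rightarrow> 'v \<Rightarrow> 'v \<Rightarrow> real ^ 2"
  where "edge_normal Q i j = Q i j /\<^sub>R norm (Q i j)"

text \<open>The estimate $\lambda_{\max}(u_i, u_j)$; the node \<^term>\<open>j\<close> enters only through the normal.\<close>

definition lambda_max ::
    "real \<Rightarrow> ('v \<Rightarrow> 'v \<Rightarrow> real ^ 2) \<Rightarrow> ('v \<Rightarrow> state) \<Rightarrow> 'v \<Rightarrow> 'v \<Rightarrow> real"
  where "lambda_max g Q u i j =
    \<bar>velocity (u i) \<bullet> edge_normal Q i j\<bar> + sqrt (g * height (u i))"

text \<open>
  The coefficients $d_{ij}$ for $j \neq i$ and $d_{ii}$ are given by separate functions, and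
  \<open>viscosity\<close> is to be used for distinct neighbors only.
\<close>

definition viscosity ::
    "real \<Rightarrow> ('v \<Rightarrow> 'v \<Rightarrow> real ^ 2) \<Rightarrow> ('v \<Rightarrow> state) \<Rightarrow> 'v \<Rightarrow> 'v \<Rightarrow> real"
  where "viscosity g Q u i j =
    max (lambda_max g Q u i j * norm (Q i j)) (lambda_max g Q u j i * norm (Q j i))"

definition diag_viscosity ::
    "real \<Rightarrow> ('v \<Rightarrow> 'v set) \<Rightarrow> ('v \<Rightarrow> 'v \<Rightarrow> real ^ 2) \<Rightarrow> ('v \<Rightarrow> state) \<Rightarrow> 'v \<Rightarrow> real"
  where "diag_viscosity g I Q u i = - (\<Sum>j\<in>I i - {i}. viscosity g Q u i j)"

end

theory Submission
  imports Defs
begin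

text \<open>
  The height component of the scheme is a scalar balance law with no source. A node \<open>j\<close> enters the
  flux as the mass \<open>h\<^sub>j\<close> transported with the velocity \<open>v\<^sub>j\<close>, so the height equation can be solved
  for the new height as
  \<open>h\<^sub>i' = (1 - dt / m\<^sub>i * |d\<^sub>i\<^sub>i|) * h\<^sub>i + dt / m\<^sub>i * (\<Sum>j\<in>I(i)-{i}. (d\<^sub>i\<^sub>j - v\<^sub>j \<bullet> Q\<^sub>i\<^sub>j) * h\<^sub>j)\<close>,
  where the diagonal flux has dropped out because antisymmetry makes \<open>Q\<^sub>i\<^sub>i\<close> vanish. The first
  coefficient is positive by the restriction on the time step. The others are nonnegative because
  the viscosity is at least the wave speed of \<open>u\<^sub>j\<close> times the length of \<open>Q\<^sub>i\<^sub>j\<close>, hence at least the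
  normal speed \<open>|v\<^sub>j \<bullet> Q\<^sub>i\<^sub>j|\<close> (\<open>abs_velocity_inner_le_viscosity\<close>). So the new height is a
  combination of positive heights with nonnegative weights, and the weight of \<open>h\<^sub>i\<close> is positive.
\<close>

lemma flux_mult_height:
  assumes "height w \<noteq> 0"
  shows "(flux g w *v q) $ 1 = velocity w \<bullet> q * height w"
  using assms
  by (simp add: flux_def velocity_def Let_def matrix_vector_mult_def inner_vec_def sum_2 field_simps)

lemma source_height: "source g I Q b u i $ 1 = 0"
  by (simp add: source_def)

text \<open>
  The viscosity is a maximum over both orientations of the edge, so it is at least the one that
  uses the wave speed at \<open>j\<close>. Scaling the unit normal back by the length of \<open>Q j i\<close> recovers \<open>Q j i\<close>,
  and the gravity wave speed only adds to the bound.
\<close>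

lemma abs_velocity_inner_le_viscosity:
  assumes "g \<ge> 0" and "height (u j) \<ge> 0"
  shows "\<bar>velocity (u j) \<bullet> Q j i\<bar> \<le> viscosity g Q u i j"
proof -
  have "\<bar>velocity (u j) \<bullet> Q j i\<bar> = \<bar>velocity (u j) \<bullet> edge_normal Q j i\<bar> * norm (Q j i)"
    by (cases "Q j i = 0") (simp_all add: edge_normal_def abs_mult)
  also have "\<dots> \<le> lambda_max g Q u j i * norm (Q j i)"
    using assms by (intro mult_right_mono) (simp_all add: lambda_max_def)
  also have "\<dots> \<le> viscosity g Q u i j"
    by (simp add: viscosity_def)
  finally show ?thesis .
qed

text \<open>
  Grouping the terms of the height equation by the height that they carry exposes the sign of the
  weight of each neighbor. The flux and the viscous term can be merged into one sum over the proper
  neighbors because \<open>Q i i = - Q i i\<close> forces \<open>Q i i = 0\<close>.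
\<close>

lemma (in connectivity_graph) height_balance:
  assumes i: "i \<in> V"
    and heights: "\<And>j. j \<in> V \<Longrightarrow> height (u j) > 0"
    and scheme: "(m i / dt) *\<^sub>R (u' - u i)
        + (\<Sum>j\<in>I i. flux g (u j) *v Q i j)
        - (\<Sum>j\<in>I i - {i}. viscosity g Q u i j *\<^sub>R (u j - u i))
      = m i *\<^sub>R source g I Q b u i"
  shows "m i / dt * (height u' - height (u i)) =
      diag_viscosity g I Q u i * height (u i)
      + (\<Sum>j\<in>I i - {i}. (viscosity g Q u i j - velocity (u j) \<bullet> Q i j) * height (u j))"
proof -
  have fin: "finite (I i)"
    using finite_nodes nbhd_subset[OF i] by (rule rev_finite_subset)
  have "2 *\<^sub>R Q i i = Q i i + - Q i i"
    unfolding scaleR_2 using Q_antisym[OF i nbhd_refl[OF i]] by (rule arg_cong)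
  then have diag: "Q i i = 0"
    by simp
  have "(\<Sum>j\<in>I i. flux g (u j) *v Q i j) = (\<Sum>j\<in>I i - {i}. flux g (u j) *v Q i j)"
    using fin nbhd_refl[OF i] by (simp add: sum.remove diag)
  then have "(\<Sum>j\<in>I i. flux g (u j) *v Q i j) $ 1 =
      (\<Sum>j\<in>I i - {i}. (flux g (u j) *v Q i j) $ 1)"
    by simp
  also have "\<dots> = (\<Sum>j\<in>I i - {i}. velocity (u j) \<bullet> Q i j * height (u j))"
  proof (rule sum.cong[OF refl])
    fix j assume "j \<in> I i - {i}"
    then have "height (u j) \<noteq> 0"
      using nbhd_subset[OF i] heights[of j] by auto
    then show "(flux g (u j) *v Q i j) $ 1 = velocity (u j) \<bullet> Q i j * height (u j)"
      by (rule flux_mult_height)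
  qed
  finally have "(\<Sum>j\<in>I i. flux g (u j) *v Q i j) $ 1 =
      (\<Sum>j\<in>I i - {i}. velocity (u j) \<bullet> Q i j * height (u j))" .
  moreover have "(\<Sum>j\<in>I i - {i}. viscosity g Q u i j *\<^sub>R (u j - u i)) $ 1 =
      (\<Sum>j\<in>I i - {i}. viscosity g Q u i j * height (u j))
      + diag_viscosity g I Q u i * height (u i)"
    by (simp add: height_def diag_viscosity_def sum_distrib_right sum_subtractf right_diff_distrib)
  moreover have "m i / dt * (height u' - height (u i))
      + (\<Sum>j\<in>I i. flux g (u j) *v Q i j) $ 1
      - (\<Sum>j\<in>I i - {i}. viscosity g Q u i j *\<^sub>R (u j - u i)) $ 1 = 0"
    using arg_cong[OF scheme, of "\<lambda>w. w $ 1"] by (simp add: height_def source_height)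
  ultimately show ?thesis
    unfolding left_diff_distrib sum_subtractf by linarith
qed

theorem theorem3p1:
  fixes V :: "'v set"
    and I :: "'v \<Rightarrow> 'v set"
    and m :: "'v \<Rightarrow> real"
    and Q :: "'v \<Rightarrow> 'v \<Rightarrow> real ^ 2"
    and b :: "'v \<Rightarrow> real"
    and g dt :: real
    and u :: "nat \<Rightarrow> 'v \<Rightarrow> state"
    and n :: nat
  assumes graph: "connectivity_graph V I m Q"
    and gravity: "g > 0"
    and scheme: "\<forall>i\<in>V.
      (m i / dt) *\<^sub>R (u (Suc n) i - u n i)
        + (\<Sum>j\<in>I i. flux g (u n j) *v Q i j)
        - (\<Sum>j\<in>I i - {i}. viscosity g Q (u n) i j *\<^sub>R (u n j - u n i))
      = m i *\<^sub>R source g I Q b (u n) i"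
    and dt_pos: "dt > 0"
    and cfl: "\<forall>i\<in>V. 2 * dt * \<bar>diag_viscosity g I Q (u n) i\<bar> < m i"
    and heights: "\<forall>i\<in>V. height (u n i) > 0"
  shows "\<forall>i\<in>V. height (u (Suc n) i) > 0"
proof
  fix i assume i: "i \<in> V"
  interpret connectivity_graph V I m Q by (rule graph)
  let ?d = "diag_viscosity g I Q (u n) i"
  have "0 \<le> (\<Sum>j\<in>I i - {i}.
      (viscosity g Q (u n) i j - velocity (u n j) \<bullet> Q i j) * height (u n j))"
  proof (intro sum_nonneg mult_nonneg_nonneg)
    fix j assume "j \<in> I i - {i}"
    then have j: "j \<in> I i" "j \<in> V"
      using nbhd_subset[OF i] by auto
    show "0 \<le> height (u n j)"
      using heights j by (simp add: less_imp_le)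
    then have "\<bar>velocity (u n j) \<bullet> Q j i\<bar> \<le> viscosity g Q (u n) i j"
      using gravity by (intro abs_velocity_inner_le_viscosity) simp_all
    then show "0 \<le> viscosity g Q (u n) i j - velocity (u n j) \<bullet> Q i j"
      using Q_antisym[OF i j(1)] by simp
  qed
  moreover have "m i / dt * (height (u (Suc n) i) - height (u n i)) = ?d * height (u n i)
      + (\<Sum>j\<in>I i - {i}.
          (viscosity g Q (u n) i j - velocity (u n j) \<bullet> Q i j) * height (u n j))"
  proof (rule height_balance[OF i])
    show "height (u n j) > 0" if "j \<in> V" for j
      using heights that by (rule bspec)
  qed (rule bspec[OF scheme i])
  moreover have "- (m i / dt) * height (u n i) < ?d * height (u n i)"
  proof (rule mult_strict_right_mono)
    have "0 \<le> dt * \<bar>?d\<bar>"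
      using dt_pos by simp
    then have "\<bar>?d\<bar> * dt < m i"
      using bspec[OF cfl i] by (simp add: mult.commute)
    then have "\<bar>?d\<bar> < m i / dt"
      using dt_pos by (simp add: pos_less_divide_eq)
    then show "- (m i / dt) < ?d"
      by linarith
  qed (rule bspec[OF heights i])
  ultimately have "0 < m i / dt * height (u (Suc n) i)"
    unfolding right_diff_distrib by linarith
  moreover have "0 < m i / dt"
    using mass_pos[OF i] dt_pos by simp
  ultimately show "height (u (Suc n) i) > 0"
    by (rule zero_less_mult_pos)
qed

end
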